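(* Let $F$ be a field and let $R\colon F[x]\to F[x]$ be an injective Rota--Baxter operator of weight $1$. (a) If $\operatorname{char} F = p>0$, then $R=-\mathrm{id}$. (b) If $\operatorname{char} F = 0$, then either $R=-\mathrm{id}$, or there exists an $F$-algebra automorphism $\psi$ of $F[x]$ such that $\psi^{-1}R\psi=R_0$, where $R_0\colon F[x]\to F[x]$ is the $F$-linear operator defined by $R_0(1)=x$ and $R_0(x^n)=(-1)^{n+1}F_n(-x)$ for all $n\ge 1$.
   Context: A Rota--Baxter operator of weight $1$ on $F[x]$ is an $F$-linear map $R\colon F[x]\to F[x]$ such that $R(f)R(g)=R\big(R(f)g+fR(g)\big)+R(fg)$ for all $f,g\in F[x]$. For $n\ge 1$ and $\operatorname{char} F=0$, $F_n$ denotes the Faulhaber polynomial, i.e. the polynomial with rational coefficients (viewed in $F$) satisfying $F_n(m)=\sum_{j=1}^{m}j^n$ for all natural $m$; explicitly $F_n(m)=\frac{1}{n+1}\sum_{j=0}^n(-1)^j\binom{n+1}{j}B_j m^{n+1-j}$, where $B_0=1,B_1=-\tfrac12,\ldots,B_n$ are the Bernoulli numbers. For example, $F_1(m)=m(m+1)/2$. The expression $F_n(-x)$ means the polynomial $F_n$ evaluated at $-x$. *)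

theory Defs
  imports Complex_Main "HOL-Computational_Algebra.Computational_Algebra"
begin

definition rota_baxter_weight1 :: "('a::field poly \<Rightarrow> 'a poly) \<Rightarrow> bool" where
  "rota_baxter_weight1 R \<longleftrightarrow>
     Vector_Spaces.linear smult smult R \<and>
     (\<forall>f g. R f * R g = R (R f * g + f * R g) + R (f * g))"

definition poly_algebra_automorphism :: "('a::field poly \<Rightarrow> 'a poly) \<Rightarrow> bool" where
  "poly_algebra_automorphism \<psi> \<longleftrightarrow>
     Vector_Spaces.linear smult smult \<psi> \<and> \<psi> 1 = 1 \<and>
     (\<forall>f g. \<psi> (f * g) = \<psi> f * \<psi> g) \<and> bij \<psi>"

text \<open>The recursion is the usual \<open>\<Sum>k\<le>n. (n + 1 choose k) * B k = 0\<close> for \<open>n \<ge> 1\<close>, giving the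
  convention \<open>B 1 = -1/2\<close>.\<close>

fun bernoulli :: "nat \<Rightarrow> rat" where
  "bernoulli 0 = 1"
| "bernoulli (Suc n) =
     - (\<Sum>k\<le>n. of_nat (Suc (Suc n) choose k) * bernoulli k) / of_nat (Suc (Suc n))"

definition faulhaber_rat :: "nat \<Rightarrow> rat poly" where
  "faulhaber_rat n = smult (1 / of_nat (n + 1))
     (\<Sum>j\<le>n. monom ((-1) ^ j * of_nat ((n + 1) choose j) * bernoulli j) (n + 1 - j))"

text \<open>The embedding of the rationals into a field of characteristic 0. It is \<^const>\<open>of_rat\<close>
  (see \<open>rat_to_field_eq_of_rat\<close>), but for the class of all fields; in positive
  characteristic its values are irrelevant.\<close>

definition rat_to_field :: "rat \<Rightarrow> 'a::field" where
  "rat_to_field r = of_int (fst (quotient_of r)) / of_int (snd (quotient_of r))"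

definition faulhaber :: "nat \<Rightarrow> 'a::field poly" where
  "faulhaber n = map_poly rat_to_field (faulhaber_rat n)"

text \<open>On monomials, \<open>R0\<close> sends \<open>1\<close> to \<open>x\<close> and \<open>x ^ n\<close> to \<open>(-1) ^ (n + 1) * F n (-x)\<close> for
  \<open>n \<ge> 1\<close>; \<open>R0\<close> is the linear extension.\<close>

definition R0_monomial :: "nat \<Rightarrow> 'a::field poly" where
  "R0_monomial n = (if n = 0 then [:0, 1:]
     else smult ((-1) ^ (n + 1)) (pcompose (faulhaber n) [:0, -1:]))"

definition R0 :: "'a::field poly \<Rightarrow> 'a poly" where
  "R0 f = (\<Sum>i\<le>degree f. smult (coeff f i) (R0_monomial i))"


lemma vector_space_smult: "vector_space (smult :: 'a::field \<Rightarrow> 'a poly \<Rightarrow> 'a poly)"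
  by unfold_locales (auto simp: smult_add_right smult_add_left)

lemma linear_smult_iff:
  "Vector_Spaces.linear smult smult (f :: 'a::field poly \<Rightarrow> 'a poly) \<longleftrightarrow>
     (\<forall>p q. f (p + q) = f p + f q) \<and> (\<forall>c p. f (smult c p) = smult c (f p))"
  unfolding Vector_Spaces.linear_iff_module_hom module_hom_iff
  using vector_space_smult by (auto simp: module_iff_vector_space)

lemma R0_eq_sum:
  assumes "degree f \<le> N"
  shows   "R0 f = (\<Sum>i\<le>N. smult (coeff f i) (R0_monomial i))"
  unfolding R0_def using assms
  by (intro sum.mono_neutral_left) (auto simp: coeff_eq_0)

lemma smult_sum_right: "smult c (\<Sum>i\<in>A. f i) = (\<Sum>i\<in>A. smult c (f i))"
  by (induction A rule: infinite_finite_induct) (auto simp: smult_add_right)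

lemma linear_R0: "Vector_Spaces.linear smult smult (R0 :: 'a::field poly \<Rightarrow> 'a poly)"
  unfolding linear_smult_iff
proof safe
  fix p q :: "'a poly" and c :: 'a
  define N where "N = max (degree p) (degree q)"
  have N: "degree p \<le> N" "degree q \<le> N" "degree (p + q) \<le> N"
    unfolding N_def by (auto intro: degree_add_le_max)
  show "R0 (p + q) = R0 p + R0 q"
    by (simp add: N R0_eq_sum[where N = N] smult_add_left sum.distrib)
  have "degree (smult c p) \<le> N"
    using N(1) degree_smult_le le_trans by blast
  then show "R0 (smult c p) = smult c (R0 p)"
    by (simp add: N R0_eq_sum[where N = N] smult_sum_right)
qed

lemma R0_monom: "R0 (monom 1 n) = (R0_monomial n :: 'a::field poly)"
proof -
  have "R0 (monom 1 n) = (\<Sum>i\<le>n. if i = n then R0_monomial i else 0 :: 'a poly)"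
    unfolding R0_def by (intro sum.cong) (auto simp: degree_monom_eq)
  then show ?thesis by simp
qed

lemma R0_one: "R0 1 = ([:0, 1:] :: 'a::field poly)"
  using R0_monom[of 0] by (simp add: R0_monomial_def)

lemma R0_power:
  assumes "n \<ge> 1"
  shows "R0 ([:0, 1:] ^ n) =
           (smult ((-1) ^ (n + 1)) (pcompose (faulhaber n) [:0, -1:]) :: 'a::field poly)"
  using R0_monom[of n] assms by (simp add: R0_monomial_def monom_altdef)

lemma rat_to_field_eq_of_rat: "rat_to_field = (of_rat :: rat \<Rightarrow> 'a::field_char_0)"
proof
  fix r :: rat
  obtain a b where "quotient_of r = (a, b)" by force
  then show "rat_to_field r = (of_rat r :: 'a)"
    using quotient_of_denom_pos quotient_of_div[of r a b]
    by (fastforce simp: rat_to_field_def of_rat_divide)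
qed

lemma bernoulli_sum:
  "(\<Sum>k<n. of_nat (n choose k) * bernoulli k) = (if n = 1 then 1 else 0)"
proof (cases n)
  case (Suc m)
  then show ?thesis
  proof (cases m)
    case (Suc l)
    have "of_nat (Suc (Suc l) choose Suc l) * bernoulli (Suc l)
            = - (\<Sum>k\<le>l. of_nat (Suc (Suc l) choose k) * bernoulli k)"
      using binomial_symmetric[of "Suc l" "Suc (Suc l)"]
      by (simp del: of_nat_Suc of_nat_add binomial_Suc_Suc)
    then show ?thesis using \<open>n = Suc m\<close> Suc
      by (simp only: lessThan_Suc_atMost sum.atMost_Suc) simp
  qed simp
qed simp

lemma faulhaber_rat_diff:
  "poly (faulhaber_rat n) x - poly (faulhaber_rat n) (x - 1) = x ^ n"
proof -
  define N where "N = n + 1"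
  define b where "b j = (-1) ^ j * of_nat (N choose j) * bernoulli j" for j
  have ev: "poly (faulhaber_rat n) y = (\<Sum>j\<le>n. b j * y ^ (N - j)) / of_nat N" for y
    by (simp add: faulhaber_rat_def poly_sum poly_monom b_def N_def)
  have binom: "y ^ k - (y - 1) ^ k = (\<Sum>i<k. of_nat (k choose i) * (-1) ^ (k - i + 1) * y ^ i)"
    for y :: rat and k
  proof -
    have "(y - 1) ^ k = (\<Sum>i\<le>k. of_nat (k choose i) * y ^ i * (-1) ^ (k - i))"
      using binomial_ring[of y "-1" k] by simp
    also have "\<dots> = y ^ k + (\<Sum>i<k. of_nat (k choose i) * y ^ i * (-1) ^ (k - i))"
      by (simp flip: lessThan_Suc_atMost)
    finally show ?thesis by (simp add: sum_negf[symmetric] mult_ac)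
  qed
  have "of_nat N * (poly (faulhaber_rat n) x - poly (faulhaber_rat n) (x - 1))
          = (\<Sum>j\<le>n. b j * (x ^ (N - j) - (x - 1) ^ (N - j)))"
  proof -
    have "of_nat N \<noteq> (0 :: rat)" by (simp add: N_def del: of_nat_Suc)
    then show ?thesis
      unfolding ev by (simp add: sum_subtractf right_diff_distrib)
  qed
  also have "\<dots> = (\<Sum>j<N. \<Sum>i<N - j. b j * (of_nat ((N - j) choose i) * (-1) ^ (N - j - i + 1) * x ^ i))"
    by (simp add: binom sum_distrib_left N_def lessThan_Suc_atMost)
  also have "\<dots> = (\<Sum>i<N. \<Sum>j<N - i. b j * (of_nat ((N - j) choose i) * (-1) ^ (N - j - i + 1) * x ^ i))"
  proof -
    have *: "{..<N - j} = {i \<in> {..<N}. i + j < N}" "{..<N - j} = {i \<in> {..<N}. j + i < N}" for j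
      by auto
    show ?thesis
      by (subst *(1), subst *(2), rule sum.swap_restrict) auto
  qed
  also have "\<dots> = (\<Sum>i<N. of_nat (N choose i) * (-1) ^ (N - i + 1) * x ^ i *
                     (\<Sum>j<N - i. of_nat ((N - i) choose j) * bernoulli j))"
    unfolding sum_distrib_left
  proof (intro sum.cong refl)
    fix i j assume "i \<in> {..<N}" and j: "j \<in> {..<N - i}"
    have sgn: "(-1) ^ j * (-1) ^ (N - j - i + 1) = ((-1) ^ (N - i + 1) :: rat)"
      using j by (simp flip: power_add)
    have "(N choose j) * ((N - j) choose i) = (N choose i) * ((N - i) choose j)"
    proof -
      have "(N choose (i + j)) * ((i + j) choose j) = (N choose j) * ((N - j) choose i)"
        using choose_mult[of j "i + j" N] j by simp
      moreover have "(N choose (i + j)) * ((i + j) choose i) = (N choose i) * ((N - i) choose j)"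
        using choose_mult[of i "i + j" N] j by simp
      moreover have "(i + j) choose j = (i + j) choose i"
        using binomial_symmetric[of i "i + j"] by simp
      ultimately show ?thesis by simp
    qed
    then have ch: "of_nat (N choose j) * of_nat ((N - j) choose i)
        = (of_nat (N choose i) * of_nat ((N - i) choose j) :: rat)"
      by (metis of_nat_mult)
    have "b j * (of_nat ((N - j) choose i) * (-1) ^ (N - j - i + 1) * x ^ i) =
        ((-1) ^ j * (-1) ^ (N - j - i + 1)) * (of_nat (N choose j) * of_nat ((N - j) choose i))
          * bernoulli j * x ^ i"
      by (simp only: b_def mult_ac)
    then show "b j * (of_nat ((N - j) choose i) * (-1) ^ (N - j - i + 1) * x ^ i) =
        of_nat (N choose i) * (-1) ^ (N - i + 1) * x ^ i * (of_nat ((N - i) choose j) * bernoulli j)"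
      unfolding sgn ch by (simp only: mult_ac)
  qed
  also have "\<dots> = (\<Sum>i<N. if i = n then of_nat N * x ^ n else 0)"
    unfolding bernoulli_sum by (intro sum.cong) (auto simp: N_def algebra_simps)
  also have "\<dots> = of_nat N * x ^ n" by (simp add: N_def)
  finally show ?thesis
    unfolding N_def by (metis Suc_eq_plus1 mult_cancel_left of_nat_neq_0)
qed

lemma faulhaber_rat_eval: 
  "poly (faulhaber_rat n) (of_nat m) = (\<Sum>j=1..m. of_nat j ^ n)"
proof (induction m)
  case 0
  show ?case by (auto simp: faulhaber_rat_def poly_sum poly_monom intro!: sum.neutral)
next
  case (Suc m)
  show ?case using faulhaber_rat_diff[of n "of_nat (Suc m)"] Suc by (simp add: algebra_simps)
qed

context
  assumes char0: "CHAR('a::field) = 0"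
begin

lemma of_int_neq_0_char0: "k \<noteq> 0 \<Longrightarrow> (of_int k :: 'a) \<noteq> 0"
  using char0 by (simp add: of_int_eq_0_iff_char_dvd)

lemma rat_to_field_divide:
  assumes "b \<noteq> 0"
  shows "rat_to_field (of_int a / of_int b) = (of_int a / of_int b :: 'a)"
proof -
  obtain c d where cd: "quotient_of (of_int a / of_int b) = (c, d)" by force
  then have d: "d \<noteq> 0" using quotient_of_denom_pos by fastforce
  have "of_int a / of_int b = (of_int c / of_int d :: rat)"
    using quotient_of_div[OF cd] .
  then have "of_int (a * d) = (of_int (c * b) :: rat)"
    using assms d by (simp add: field_simps)
  then have "a * d = c * b" by (simp only: of_int_eq_iff)
  then have "of_int a * of_int d = (of_int c * of_int b :: 'a)"
    by (metis of_int_mult)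
  then show ?thesis
    using of_int_neq_0_char0[OF d] of_int_neq_0_char0[OF assms]
    by (simp add: rat_to_field_def cd field_simps)
qed

lemma rat_cases_int:
  obtains a b where "b \<noteq> 0" "r = (of_int a / of_int b :: rat)"
  by (metis quotient_of_denom_pos quotient_of_div surj_pair less_irrefl)

lemma rat_to_field_of_int: "rat_to_field (of_int k) = (of_int k :: 'a)"
  using rat_to_field_divide[of 1 k] by simp

lemma rat_to_field_add: "rat_to_field (r + s) = (rat_to_field r + rat_to_field s :: 'a)"
proof -
  obtain a b where 1: "b \<noteq> 0" "r = (of_int a / of_int b :: rat)" by (rule rat_cases_int)
  obtain c d where 2: "d \<noteq> 0" "s = (of_int c / of_int d :: rat)" by (rule rat_cases_int)
  have "r + s = of_int (a * d + c * b) / of_int (b * d)"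
    using 1 2 by (simp add: field_simps)
  then have "rat_to_field (r + s) = (of_int (a * d + c * b) / of_int (b * d) :: 'a)"
    using rat_to_field_divide[of "b * d" "a * d + c * b"] 1 2 by simp
  then show ?thesis
    using rat_to_field_divide[OF 1(1), of a] rat_to_field_divide[OF 2(1), of c]
      of_int_neq_0_char0[OF 1(1)] of_int_neq_0_char0[OF 2(1)]
    unfolding 1(2)[symmetric] 2(2)[symmetric] by (simp add: add_frac_eq)
qed

lemma rat_to_field_mult: "rat_to_field (r * s) = (rat_to_field r * rat_to_field s :: 'a)"
proof -
  obtain a b where 1: "b \<noteq> 0" "r = (of_int a / of_int b :: rat)" by (rule rat_cases_int)
  obtain c d where 2: "d \<noteq> 0" "s = (of_int c / of_int d :: rat)" by (rule rat_cases_int)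
  have "r * s = of_int (a * c) / of_int (b * d)"
    using 1 2 by simp
  then have "rat_to_field (r * s) = (of_int (a * c) / of_int (b * d) :: 'a)"
    using rat_to_field_divide[of "b * d" "a * c"] 1 2 by simp
  then show ?thesis
    using 1 2 by (simp add: rat_to_field_divide)
qed

lemma poly_map_rat_to_field:
  "poly (map_poly rat_to_field p) (rat_to_field x) = (rat_to_field (poly p x) :: 'a)"
proof (induction p)
  case 0
  show ?case using rat_to_field_of_int[of 0] by simp
next
  case (pCons c p)
  then show ?case using rat_to_field_of_int[of 0]
    by (simp add: map_poly_pCons rat_to_field_add rat_to_field_mult)
qed

text \<open>The property characterising the Faulhaber polynomials.\<close>

lemma faulhaber_eval: "poly (faulhaber n) (of_nat m) = (\<Sum>j=1..m. of_nat j ^ n :: 'a)"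
proof -
  have nat: "rat_to_field (of_nat k) = (of_nat k :: 'a)" for k
    using rat_to_field_of_int[of "int k"] by simp
  have "poly (faulhaber n) (of_nat m) = (rat_to_field (\<Sum>j=1..m. of_nat j ^ n) :: 'a)"
    unfolding faulhaber_def nat[of m, symmetric] poly_map_rat_to_field faulhaber_rat_eval ..
  also have "(\<Sum>j=1..m. of_nat j ^ n) = (of_nat (\<Sum>j=1..m. j ^ n) :: rat)" by simp
  finally show ?thesis unfolding nat by simp
qed

end

end

theory Submission
  imports Defs
begin

text \<open>
  Let \<open>B\<close> be the range of \<open>R\<close>. As \<open>R\<close> is injective, every \<open>b = R f\<close> determines \<open>f\<close>, and the Rota--Baxter
  identity says precisely that \<open>\<sigma>(R f) = R f + f\<close> is a multiplicative map from \<open>B\<close> to \<open>F[x]\<close>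
  (\<open>\<sigma>_mult\<close>). So \<open>R\<close> is the inverse of a difference operator \<open>\<sigma> - id\<close> which maps \<open>B\<close> bijectively onto
  \<open>F[x]\<close>; in particular \<open>\<sigma>\<close> fixes no nonzero element. Put \<open>g = R 1\<close>, so that \<open>\<sigma> g = g + 1\<close>.

  If \<open>g\<close> is constant, then \<open>1 \<in> B\<close>, and \<open>\<sigma> 1\<close> is an idempotent other than \<open>1\<close>; hence \<open>\<sigma> = 0\<close> and
  \<open>R = - id\<close> (\<open>minus_id_if_degree_g_eq_0\<close>). In characteristic \<open>p > 0\<close> this always happens, since
  \<open>g\<^sup>p - g\<close> is fixed by \<open>\<sigma>\<close> (\<open>degree_g_eq_0_if_prime_char\<close>).

  Let \<open>g\<close> be nonconstant and the characteristic \<open>0\<close>. The crux is that \<open>g\<close> has degree \<open>1\<close>. Since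
  \<open>F[x] = (\<sigma> - id) B\<close> is contained in \<open>\<sigma> B + B\<close>, comparing ranks over \<open>F[g]\<close> shows that \<open>B\<close> is
  so large that \<open>x b \<in> B\<close> for some nonzero \<open>b \<in> B\<close> (\<open>multiple_of_x_in_range\<close>). It follows that \<open>B\<close>
  contains a nonzero ideal of \<open>F[x]\<close> (\<open>conductor\<close>), by means of which \<open>\<sigma>\<close> extends to an endomorphism
  of \<open>F[x]\<close>, that is, to a substitution of some polynomial \<open>s\<close> for \<open>x\<close>
  (\<open>shift_is_substitution\<close>). From \<open>g(s) = g + 1\<close> it is elementary that \<open>g\<close> is linear
  (\<open>degree_1_if_composition_shifts\<close>).

  Then \<open>\<psi>(f) = f(g)\<close> is an automorphism. The model operator is the summation operator, characterised
  by inverting the forward difference and by values that vanish at \<open>0\<close>, and \<open>\<psi>\<close> carries it to \<open>R\<close>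
  (\<open>R_pcompose_g\<close>).
\<close>

section \<open>Linear algebra over the subring generated by one polynomial\<close>

lemma pcompose_monom: "pcompose (monom c i) g = smult c (g ^ i :: 'a::comm_semiring_1 poly)"
  by (induction i) (auto simp: monom_0 monom_Suc pcompose_pCons)

text \<open>Gaussian elimination without division: eliminating one equation uses up one unknown, and the
  pivot enters only as a nonzero factor. Over an integral domain this replaces the dimension theory
  of the fraction field in all rank arguments below.\<close>

lemma homogeneous_system_nontrivial_solution:
  fixes q :: "'i \<Rightarrow> 'j \<Rightarrow> 'a::idom"
  assumes "finite T" and "finite S" and "card T < card S"
  shows "\<exists>p. (\<exists>s\<in>S. p s \<noteq> 0) \<and> (\<forall>t\<in>T. (\<Sum>s\<in>S. p s * q s t) = 0)"
  using assms
proof (induction T arbitrary: S q rule: finite_induct)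
  case empty
  then have "S \<noteq> {}" by auto
  then show ?case by (intro exI[of _ "\<lambda>_. 1"]) auto
next
  case (insert t T)
  show ?case
  proof (cases "\<forall>s\<in>S. q s t = 0")
    case True
    have "card T < card S" using insert by simp
    then obtain p where "\<exists>s\<in>S. p s \<noteq> 0" "\<forall>u\<in>T. (\<Sum>s\<in>S. p s * q s u) = 0"
      using insert.IH[of S q] insert.prems by blast
    then show ?thesis using True by (intro exI[of _ p]) auto
  next
    case False
    then obtain s0 where s0: "s0 \<in> S" "q s0 t \<noteq> 0" by blast
    define S' where "S' = S - {s0}"
    have S': "finite S'" "card T < card S'"
      using insert s0 by (auto simp: S'_def)
    define q' where "q' s u = q s0 t * q s u - q s t * q s0 u" for s u
    obtain p' where p': "\<exists>s\<in>S'. p' s \<noteq> 0" "\<And>u. u \<in> T \<Longrightarrow> (\<Sum>s\<in>S'. p' s * q' s u) = 0"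
      using insert.IH[OF S', of q'] by blast
    define p where "p s = (if s = s0 then - (\<Sum>s\<in>S'. p' s * q s t) else p' s * q s0 t)" for s
    have p_sum: "(\<Sum>s\<in>S. p s * q s u) = (\<Sum>s\<in>S'. p' s * q' s u)" for u
    proof -
      have "(\<Sum>s\<in>S. p s * q s u) = p s0 * q s0 u + (\<Sum>s\<in>S'. p s * q s u)"
        using s0 insert.prems by (simp add: S'_def sum.remove)
      also have "(\<Sum>s\<in>S'. p s * q s u) = (\<Sum>s\<in>S'. p' s * q s0 t * q s u)"
        by (intro sum.cong) (auto simp: S'_def p_def)
      also have "p s0 * q s0 u = (\<Sum>s\<in>S'. - (p' s * q s t * q s0 u))"
        by (simp add: p_def sum_distrib_right sum_negf)
      finally show ?thesis
        by (simp add: q'_def sum.distrib[symmetric] algebra_simps)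
    qed
    have "\<forall>u\<in>insert t T. (\<Sum>s\<in>S. p s * q s u) = 0"
      using p'(2) by (auto simp: p_sum) (simp add: q'_def)
    moreover have "\<exists>s\<in>S. p s \<noteq> 0"
      using p'(1) s0 by (auto simp: p_def S'_def)
    ultimately show ?thesis by blast
  qed
qed

text \<open>In characteristic 0 the natural numbers are infinitely many points of the field.\<close>

lemma poly_eqI_of_nat:
  fixes p q :: "'a::field poly"
  assumes "CHAR('a) = 0" and "\<And>m. poly p (of_nat m) = poly q (of_nat m)"
  shows "p = q"
proof (rule ccontr)
  assume "p \<noteq> q"
  then have "finite {x. poly (p - q) x = 0}" by (intro poly_roots_finite) simp
  then have "finite (range (of_nat :: nat \<Rightarrow> 'a))"
    by (rule rev_finite_subset) (use assms(2) in auto)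
  moreover have "inj (of_nat :: nat \<Rightarrow> 'a)"
    unfolding inj_def
  proof safe
    fix x y :: nat
    assume "of_nat x = (of_nat y :: 'a)"
    then show "x = y"
      using assms(1) of_nat_eq_iff_char_dvd[of x y, where ?'a = 'a]
        of_nat_eq_iff_char_dvd[of y x, where ?'a = 'a]
      by (cases x y rule: linorder_cases) auto
  qed
  ultimately show False using finite_imageD infinite_UNIV_nat by blast
qed

text \<open>Repeated division by \<open>g\<close>, as in writing a number in base \<open>g\<close>: the powers of \<open>x\<close> below the degree of
  \<open>g\<close> generate \<open>F[x]\<close> as a module over \<open>F[g]\<close>.\<close>

lemma expansion_in_powers_of_poly:
  fixes g :: "'a::field poly"
  assumes "degree g > 0"
  shows "\<exists>q. f = (\<Sum>i<degree g. pcompose (q i) g * [:0, 1:] ^ i)"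
proof (induction "degree f" arbitrary: f rule: less_induct)
  case less
  show ?case
  proof (cases "f = 0")
    case True
    then show ?thesis by (intro exI[of _ "\<lambda>_. 0"]) simp
  next
    case False
    have "\<exists>q. f div g = (\<Sum>i<degree g. pcompose (q i) g * [:0, 1:] ^ i)"
    proof (cases "f div g = 0")
      case True
      then show ?thesis by (intro exI[of _ "\<lambda>_. 0"]) simp
    next
      case nz: False
      then have "degree (f div g) < degree f"
        using assms degree_div_less[of f g] by (metis bot_nat_0.not_eq_extremum degree_0 div_poly_eq_0_iff False not_gr_zero)
      then show ?thesis using less by blast
    qed
    then obtain q where q: "f div g = (\<Sum>i<degree g. pcompose (q i) g * [:0, 1:] ^ i)" by blast
    have "f mod g = (\<Sum>i<degree g. [:coeff (f mod g) i:] * [:0, 1:] ^ i)"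
    proof -
      have d: "degree (f mod g) < degree g"
        using assms degree_mod_less[of g f] by (metis degree_0 less_numeral_extra(3))
      have "f mod g = (\<Sum>i\<le>degree (f mod g). monom (coeff (f mod g) i) i)"
        by (simp add: poly_as_sum_of_monoms)
      also have "\<dots> = (\<Sum>i<degree g. monom (coeff (f mod g) i) i)"
        by (intro sum.mono_neutral_left) (use d in \<open>auto simp: coeff_eq_0\<close>)
      finally show ?thesis by (simp add: monom_altdef)
    qed
    then have "f = (\<Sum>i<degree g. pcompose (pCons (coeff (f mod g) i) (q i)) g * [:0, 1:] ^ i)"
      using div_mult_mod_eq[of f g] unfolding q
      by (simp add: pcompose_pCons ring_distribs sum.distrib sum_distrib_left sum_distrib_right mult_ac
          add.commute)
    then show ?thesis by (intro exI)
  qed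
qed

text \<open>A scalar \<open>p(g)\<close> is represented by \<open>p\<close>. For nonconstant \<open>g\<close> the polynomial \<open>p\<close> is determined by
  \<open>p(g)\<close>, and this is linear independence over \<open>F[g]\<close>.\<close>

definition indep_over :: "'a::field poly \<Rightarrow> 'a poly set \<Rightarrow> bool" where
  "indep_over g S \<longleftrightarrow> finite S \<and>
     (\<forall>p. (\<Sum>s\<in>S. pcompose (p s) g * s) = 0 \<longrightarrow> (\<forall>s\<in>S. p s = 0))"

text \<open>\<open>F[x]\<close> is generated over \<open>F[g]\<close> by \<open>degree g\<close> elements, so more elements than that satisfy a relation.\<close>

lemma card_indep_over_le:
  fixes g :: "'a::field poly"
  assumes "indep_over g S" and "degree g > 0"
  shows "card S \<le> degree g"
proof (rule ccontr)
  assume "\<not> card S \<le> degree g"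
  obtain q where q: "\<And>s. s = (\<Sum>i<degree g. pcompose (q s i) g * [:0, 1:] ^ i)"
    using expansion_in_powers_of_poly[OF assms(2)] by metis
  have "finite S" using assms(1) by (simp add: indep_over_def)
  then obtain p where p: "\<exists>s\<in>S. p s \<noteq> 0" "\<And>i. i < degree g \<Longrightarrow> (\<Sum>s\<in>S. p s * q s i) = 0"
    using homogeneous_system_nontrivial_solution[of "{..<degree g}" S q] \<open>\<not> card S \<le> degree g\<close> by auto
  have "(\<Sum>s\<in>S. pcompose (p s) g * s)
      = (\<Sum>s\<in>S. \<Sum>i<degree g. pcompose (p s * q s i) g * [:0, 1:] ^ i)"
    by (subst (2) q) (simp add: sum_distrib_left pcompose_mult mult_ac)
  also have "\<dots> = (\<Sum>i<degree g. pcompose (\<Sum>s\<in>S. p s * q s i) g * [:0, 1:] ^ i)"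
    by (subst sum.swap) (simp add: pcompose_sum sum_distrib_right)
  also have "\<dots> = 0" using p(2) by simp
  finally show False using assms(1) p(1) by (auto simp: indep_over_def)
qed

text \<open>A maximal independent subset of \<open>B\<close> containing a prescribed element; maximality makes every element
  of \<open>B\<close>, after multiplication by a nonzero scalar \<open>Q(g)\<close>, a combination of it.\<close>

lemma maximal_indep_over:
  fixes g :: "'a::field poly"
  assumes "degree g > 0" and "e \<in> B" and "e \<noteq> 0"
  obtains S where "indep_over g S" and "S \<subseteq> B" and "e \<in> S"
    and "\<And>b. b \<in> B \<Longrightarrow> \<exists>Q q. Q \<noteq> 0 \<and> pcompose Q g * b = (\<Sum>s\<in>S. pcompose (q s) g * s)"
proof -
  let ?P = "\<lambda>S. indep_over g S \<and> S \<subseteq> B \<and> e \<in> S"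
  have "?P {e}"
    unfolding indep_over_def using assms(2,3) pcompose_eq_0[OF _ assms(1)] by simp
  moreover have "\<forall>S. ?P S \<longrightarrow> card S < Suc (degree g)"
    using card_indep_over_le[OF _ assms(1)] by (simp add: less_Suc_eq_le)
  ultimately obtain S where S: "?P S" and max: "\<And>T. ?P T \<Longrightarrow> card T \<le> card S"
    using ex_has_greatest_nat[of ?P "{e}" card "Suc (degree g)"] by (metis (no_types, lifting))
  have fin: "finite S" using S by (simp add: indep_over_def)
  have "\<exists>Q q. Q \<noteq> 0 \<and> pcompose Q g * b = (\<Sum>s\<in>S. pcompose (q s) g * s)" if "b \<in> B" for b
  proof (cases "b \<in> S")
    case True
    have "(\<Sum>s\<in>S. pcompose (if s = b then 1 else 0) g * s) = (\<Sum>s\<in>S. if s = b then s else 0)"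
      by (intro sum.cong) (auto simp: pcompose_1)
    also have "\<dots> = pcompose 1 g * b" using True fin by (simp add: pcompose_1)
    finally show ?thesis
      by (intro exI[of _ 1] exI[of _ "\<lambda>s. if s = b then 1 else 0"] conjI) (simp, rule sym)
  next
    case False
    have "\<not> indep_over g (insert b S)"
    proof
      assume "indep_over g (insert b S)"
      then have "card (insert b S) \<le> card S" using S that by (intro max) simp
      then show False using False fin by simp
    qed
    then obtain p where p: "(\<Sum>s\<in>insert b S. pcompose (p s) g * s) = 0" "\<exists>s\<in>insert b S. p s \<noteq> 0"
      using fin unfolding indep_over_def by blast
    have rel: "pcompose (p b) g * b + (\<Sum>s\<in>S. pcompose (p s) g * s) = 0"
      using p(1) fin False by simp
    have "p b \<noteq> 0"
    proof
      assume "p b = 0"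
      with rel have "(\<Sum>s\<in>S. pcompose (p s) g * s) = 0" by simp
      then have "\<forall>s\<in>S. p s = 0" using S unfolding indep_over_def by blast
      then show False using p(2) \<open>p b = 0\<close> by auto
    qed
    moreover have "pcompose (p b) g * b = (\<Sum>s\<in>S. pcompose (- p s) g * s)"
      using rel unfolding pcompose_uminus mult_minus_left sum_negf by (rule iffD2[OF eq_neg_iff_add_eq_0])
    ultimately show ?thesis
      by (intro exI[of _ "p b"] exI[of _ "\<lambda>s. - p s"] conjI)
  qed
  then show ?thesis using S by (intro that[of S]) auto
qed

text \<open>The residues of \<open>1, g, \<dots>, g\<^sup>d\<close> modulo \<open>b\<close>, with \<open>d\<close> the degree of \<open>b\<close>, are \<open>d + 1\<close> vectors in a space of
  dimension \<open>d\<close>, and a linear relation between them is the required \<open>q\<close>.\<close>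

lemma nonzero_multiple_in_subring:
  fixes b g :: "'a::field poly"
  assumes "b \<noteq> 0"
  obtains q where "q \<noteq> 0" and "b dvd pcompose q g"
proof -
  have "\<exists>p. (\<exists>i\<in>{..degree b}. p i \<noteq> 0) \<and>
      (\<forall>t\<in>{..<degree b}. (\<Sum>i\<in>{..degree b}. p i * coeff (g ^ i mod b) t) = 0)"
    by (rule homogeneous_system_nontrivial_solution) auto
  then obtain p where p: "\<exists>i\<le>degree b. p i \<noteq> 0"
    "\<And>t. t < degree b \<Longrightarrow> (\<Sum>i\<le>degree b. p i * coeff (g ^ i mod b) t) = 0"
    by auto
  define q where "q = (\<Sum>i\<le>degree b. monom (p i) i)"
  define r where "r = (\<Sum>i\<le>degree b. smult (p i) (g ^ i mod b))"
  have "r = 0"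
  proof (rule poly_eqI)
    fix t
    show "coeff r t = coeff 0 t"
    proof (cases "t < degree b")
      case True
      then show ?thesis using p(2) by (simp add: r_def coeff_sum)
    next
      case False
      have "coeff (g ^ i mod b) t = 0" for i
        using degree_mod_less[OF assms, of "g ^ i"] False by (auto intro: coeff_eq_0)
      then show ?thesis by (simp add: r_def coeff_sum)
    qed
  qed
  have "pcompose q g = (\<Sum>i\<le>degree b. smult (p i) (g ^ i))"
    by (simp add: q_def pcompose_sum pcompose_monom)
  also have "\<dots> = (\<Sum>i\<le>degree b. smult (p i) (b * (g ^ i div b) + g ^ i mod b))" by simp
  also have "\<dots> = (\<Sum>i\<le>degree b. b * smult (p i) (g ^ i div b)) + r"
    unfolding r_def sum.distrib[symmetric] by (simp add: smult_add_right[symmetric])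
  finally have "b dvd pcompose q g"
    by (auto simp: \<open>r = 0\<close> simp flip: mult_smult_right intro!: dvd_sum)
  moreover have "coeff q i = p i" if "i \<le> degree b" for i
    using that by (simp add: q_def coeff_sum)
  then have "q \<noteq> 0" using p(1) by force
  ultimately show ?thesis using that by blast
qed

section \<open>Divisibility and substitution\<close>

text \<open>The hypothesis says that all powers of \<open>u / c\<close> have the common denominator \<open>c\<close>. This property is
  inherited by \<open>r / c\<close> for the remainder \<open>r\<close> of \<open>u\<close> modulo \<open>c\<close>, as the two fractions differ by a polynomial. But
  \<open>c (r / c)\<^sup>k\<close> has negative degree for large \<open>k\<close> unless \<open>r = 0\<close>.\<close>

lemma almost_integral_imp_dvd:
  fixes c u :: "'a::field poly"
  assumes "c \<noteq> 0" and pow: "\<And>k. c ^ k dvd c * u ^ k"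
  shows "c dvd u"
proof (rule ccontr)
  assume "\<not> c dvd u"
  define r where "r = u mod c"
  define k where "k = Suc (degree c)"
  have r: "r \<noteq> 0" "degree r < degree c"
    using \<open>\<not> c dvd u\<close> assms(1) degree_mod_less[of c u] by (auto simp: r_def dvd_eq_mod_eq_0)
  have "r = u + c * (- (u div c))" unfolding r_def
    by (simp add: minus_mult_div_eq_mod)
  then have "c * r ^ k = (\<Sum>j\<le>k. of_nat (k choose j) * ((c * u ^ j) * (c * (- (u div c))) ^ (k - j)))"
    using binomial_ring[of u "c * (- (u div c))" k] by (simp add: sum_distrib_left mult_ac)
  also have "c ^ k dvd \<dots>"
  proof (rule dvd_sum, rule dvd_mult)
    fix j assume "j \<in> {..k}"
    have "c ^ j * c ^ (k - j) dvd (c * u ^ j) * (c * (- (u div c))) ^ (k - j)"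
      by (intro mult_dvd_mono pow dvd_power_same) simp
    then show "c ^ k dvd (c * u ^ j) * (c * (- (u div c))) ^ (k - j)"
      using \<open>j \<in> {..k}\<close> by (simp flip: power_add)
  qed
  finally have "degree (c ^ k) \<le> degree (c * r ^ k)"
    using assms(1) r by (intro dvd_imp_degree_le) auto
  then have "k * degree c \<le> degree c + k * degree r"
    using assms(1) r by (simp add: degree_power_eq degree_mult_eq)
  moreover have "k * Suc (degree r) \<le> k * degree c" using r(2) by (intro mult_le_mono2) simp
  ultimately show False by (simp add: k_def)
qed

text \<open>Comparing degrees, \<open>s\<close> is linear, \<open>s = c + d x\<close>. It has no fixed point, since \<open>g = g + 1\<close> would hold there; hence \<open>d = 1\<close>. Then \<open>g\<close> grows by \<open>1\<close> with every step \<open>c\<close>, so it agrees with a linear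
  polynomial at the infinitely many points \<open>m c\<close>.\<close>

lemma degree_1_if_composition_shifts:
  fixes g s :: "'a::field poly"
  assumes char0: "CHAR('a) = 0" and deg: "degree g > 0" and shift: "pcompose g s = g + 1"
  shows "degree g = 1"
proof -
  have "degree (g + 1) = degree g" by (simp add: degree_add_eq_left deg)
  then have "degree g * degree s = degree g"
    using degree_pcompose[of g s] unfolding shift by metis
  then have "degree s = 1" using deg by auto
  obtain c t where t: "s = pCons c t" by (cases s)
  with \<open>degree s = 1\<close> have "degree t = 0" "t \<noteq> 0" by (auto split: if_splits)
  then obtain d where s: "s = [:c, d:]" "d \<noteq> 0"
    unfolding t by (auto elim: degree_eq_zeroE)
  have val: "poly g (c + d * x) = poly g x + 1" for x
    using arg_cong[OF shift, of "\<lambda>p. poly p x"] by (simp add: poly_pcompose s mult_ac)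
  \<comment> \<open>For \<open>d \<noteq> 1\<close> the fixed point of \<open>s\<close> is \<open>c / (1 - d)\<close>.\<close>
  have "d = 1"
  proof (rule ccontr)
    assume "d \<noteq> 1"
    then have "c + d * (c / (1 - d)) = c / (1 - d)" by (simp add: field_simps)
    then show False using val[of "c / (1 - d)"] by simp
  qed
  have "c \<noteq> 0" using val[of 0] by auto
  have steps: "poly g (of_nat m * c) = poly g 0 + of_nat m" for m
  proof (induction m)
    case (Suc m)
    then show ?case using val[of "of_nat m * c"] \<open>d = 1\<close> by (simp add: algebra_simps)
  qed simp
  have "pcompose g [:0, c:] = [:poly g 0, 1:]"
    by (rule poly_eqI_of_nat[OF char0]) (simp add: poly_pcompose steps)
  then show ?thesis
    using degree_pcompose[of g "[:0, c:]"] \<open>c \<noteq> 0\<close> by simp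
qed

section \<open>The summation operator\<close>

text \<open>The model operator sums \<open>f(0) + \<dots> + f(x - 1)\<close>, so it inverts the forward difference. On the negated
  Faulhaber polynomials this is the recursion \<open>F\<^sub>n(m + 1) - F\<^sub>n(m) = (m + 1)\<^sup>n\<close> read at \<open>m = - x - 1\<close>. Together with
  the vanishing at \<open>0\<close> it characterises the operator.\<close>

lemma R0_monomial_shift:
  assumes "CHAR('a::field) = 0"
  shows "pcompose (R0_monomial n) [:1, 1:] - R0_monomial n = ([:0, 1:] ^ n :: 'a poly)"
proof (cases "n = 0")
  case True
  then show ?thesis by (simp add: R0_monomial_def pcompose_pCons one_pCons)
next
  case False
  let ?F = "faulhaber n :: 'a poly"
  have rec: "pcompose ?F [:1, 1:] - ?F = [:1, 1:] ^ n"
  proof (rule poly_eqI_of_nat[OF assms])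
    fix m
    show "poly (pcompose ?F [:1, 1:] - ?F) (of_nat m) = poly ([:1, 1:] ^ n) (of_nat m)"
      using faulhaber_eval[OF assms, of n m] faulhaber_eval[OF assms, of n "Suc m"]
      by (simp add: poly_pcompose poly_power)
  qed
  have "pcompose (pcompose ?F [:1, 1:] - ?F) [:-1, -1:] = pcompose ([:1, 1:] ^ n) [:-1, -1:]"
    by (simp only: rec)
  moreover have "pcompose ([:1, 1:] ^ n) [:-1, -1:] = ((- [:0, 1:]) ^ n :: 'a poly)"
  proof (induction n)
    case (Suc n)
    then show ?case unfolding power_Suc pcompose_mult by (simp add: pcompose_pCons)
  qed (simp add: pcompose_1)
  ultimately have "pcompose ?F [:0, -1:] - pcompose ?F [:-1, -1:] = (- [:0, 1:]) ^ n"
    by (simp add: pcompose_diff pcompose_assoc[symmetric] pcompose_pCons)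
  moreover have "pcompose (R0_monomial n) [:1, 1:] - R0_monomial n
     = smult ((-1) ^ n) (pcompose ?F [:0, -1:] - pcompose ?F [:-1, -1:])"
  proof -
    have "pcompose (pcompose ?F [:0, -1:]) [:1, 1:] = pcompose ?F [:-1, -1:]"
      by (simp add: pcompose_assoc[symmetric] pcompose_pCons)
    then show ?thesis
      using False by (simp add: R0_monomial_def pcompose_smult pcompose_uminus smult_diff_right)
  qed
  moreover have "(- [:0, 1:]) ^ n = smult ((-1) ^ n) ([:0, 1:] ^ n :: 'a poly)"
    using smult_power[of "-1" "[:0, 1:] :: 'a poly" n] by simp
  moreover have "(-1) ^ n * (-1) ^ n = (1 :: 'a)" by (simp flip: power_mult_distrib)
  ultimately show ?thesis by simp
qed

lemma poly_R0_monomial_0: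
  assumes "CHAR('a::field) = 0"
  shows "poly (R0_monomial n :: 'a poly) 0 = 0"
  using faulhaber_eval[OF assms, of n 0] by (simp add: R0_monomial_def poly_pcompose)

section \<open>The shift homomorphism of an injective operator\<close>

locale injective_rota_baxter =
  fixes R :: "'a::field poly \<Rightarrow> 'a poly"
  assumes R_add: "R (f + h) = R f + R h"
    and R_smult: "R (smult c f) = smult c (R f)"
    and R_mult: "R f * R h = R (R f * h + f * R h + f * h)"
    and inj_R: "inj R"
begin

text \<open>The identity map plus the inverse of \<open>R\<close>; meaningful on the range of \<open>R\<close> only. For the summation operator it is the
  shift \<open>b(x) \<mapsto> b(x + 1)\<close>.\<close>

definition \<sigma> :: "'a poly \<Rightarrow> 'a poly" where
  "\<sigma> b = b + inv R b"

lemma \<sigma>_R: "\<sigma> (R f) = R f + f"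
  by (simp add: \<sigma>_def inj_R)

lemma R_0: "R 0 = 0"
  using R_smult[of 0 0] by simp

lemma \<sigma>_0: "\<sigma> 0 = 0"
  using \<sigma>_R[of 0] by (simp add: R_0)

lemma range_add: "b \<in> range R \<Longrightarrow> c \<in> range R \<Longrightarrow> b + c \<in> range R"
  by (auto simp flip: R_add)

lemma range_smult: "b \<in> range R \<Longrightarrow> smult a b \<in> range R"
  by (auto simp flip: R_smult)

lemma range_diff: "b \<in> range R \<Longrightarrow> c \<in> range R \<Longrightarrow> b - c \<in> range R"
  using range_add[OF _ range_smult[of c "-1"]] by simp

lemma range_0: "0 \<in> range R"
  using R_0 by (metis rangeI)

lemma range_mult: "b \<in> range R \<Longrightarrow> c \<in> range R \<Longrightarrow> b * c \<in> range R"
  by (auto simp: R_mult)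

lemma range_sum: "(\<And>i. i \<in> I \<Longrightarrow> f i \<in> range R) \<Longrightarrow> sum f I \<in> range R"
  by (induction I rule: infinite_finite_induct) (auto intro: range_add range_0)

lemma \<sigma>_add: "b \<in> range R \<Longrightarrow> c \<in> range R \<Longrightarrow> \<sigma> (b + c) = \<sigma> b + \<sigma> c"
  by (auto simp: \<sigma>_R simp flip: R_add)

lemma \<sigma>_smult: "b \<in> range R \<Longrightarrow> \<sigma> (smult a b) = smult a (\<sigma> b)"
  by (auto simp: \<sigma>_R smult_add_right simp flip: R_smult)

lemma \<sigma>_sum: "(\<And>i. i \<in> I \<Longrightarrow> f i \<in> range R) \<Longrightarrow> \<sigma> (sum f I) = (\<Sum>i\<in>I. \<sigma> (f i))"
  by (induction I rule: infinite_finite_induct) (auto simp: \<sigma>_0 \<sigma>_add range_sum)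

text \<open>This is the Rota--Baxter identity: applying the inverse of \<open>R\<close> to it gives the rule for the difference of a product,
  \<open>\<Delta>(b c) = b \<Delta>c + \<Delta>b c + \<Delta>b \<Delta>c\<close> with \<open>\<Delta> = \<sigma> - id\<close>.\<close>

lemma \<sigma>_mult: "b \<in> range R \<Longrightarrow> c \<in> range R \<Longrightarrow> \<sigma> (b * c) = \<sigma> b * \<sigma> c"
proof -
  assume "b \<in> range R" "c \<in> range R"
  then obtain f h where fh: "b = R f" "c = R h" by auto
  have "\<sigma> (b * c) = R f * R h + (R f * h + f * R h + f * h)"
    unfolding fh R_mult \<sigma>_R ..
  then show ?thesis by (simp add: fh \<sigma>_R algebra_simps)
qed

text \<open>If \<open>b = R f\<close>, then \<open>\<sigma> b - b = f\<close>; so a fixed \<open>b\<close> is \<open>R 0\<close>.\<close>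

lemma \<sigma>_fixed_eq_0:
  assumes "b \<in> range R" and "\<sigma> b = b"
  shows "b = 0"
  using assms by (auto simp: \<sigma>_R R_0)

text \<open>The element that plays the part of the summation variable: \<open>\<sigma>\<close> shifts it by \<open>1\<close>.\<close>

definition g :: "'a poly" where
  "g = R 1"

lemma g_in_range: "g \<in> range R"
  by (simp add: g_def)

lemma \<sigma>_g: "\<sigma> g = g + 1"
  by (simp add: g_def \<sigma>_R)

section \<open>Constant image of one, and positive characteristic\<close>

text \<open>If \<open>R 1\<close> is constant, then \<open>1\<close> lies in the range, and \<open>\<sigma> 1\<close> is an idempotent different from \<open>1\<close>. So
  \<open>\<sigma> 1 = 0\<close>, and the multiplicative map \<open>\<sigma>\<close> vanishes altogether.\<close>

lemma minus_id_if_degree_g_eq_0: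
  assumes "degree g = 0"
  shows "R = (\<lambda>f. - f)"
proof -
  obtain c where c: "g = [:c:]" using assms by (rule degree_eq_zeroE)
  have "c \<noteq> 0"
  proof
    assume "c = 0"
    then have "R 1 = R 0" using c by (simp add: g_def R_0)
    then show False using inj_R by (metis injD zero_neq_one)
  qed
  then have "smult (1 / c) g = 1" by (simp add: c one_pCons)
  then have one: "1 \<in> range R" using range_smult[OF g_in_range, of "1 / c"] by simp
  have "\<sigma> 1 * \<sigma> 1 = \<sigma> 1" using \<sigma>_mult[OF one one] by simp
  moreover have "\<sigma> 1 \<noteq> 1" using \<sigma>_fixed_eq_0[OF one] by auto
  ultimately have "\<sigma> 1 = 0" by auto
  have "R f = - f" for f
  proof -
    have "\<sigma> (R f) = 0" using \<sigma>_mult[OF one rangeI, of f] \<open>\<sigma> 1 = 0\<close> by simp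
    then show ?thesis by (simp add: \<sigma>_R eq_neg_iff_add_eq_0)
  qed
  then show ?thesis by auto
qed

text \<open>In characteristic \<open>p\<close> the polynomial \<open>g\<^sup>p - g\<close> is invariant under \<open>g \<mapsto> g + 1\<close>, hence it is \<open>0\<close>.\<close>

lemma degree_g_eq_0_if_prime_char:
  assumes "CHAR('a) > 0"
  shows "degree g = 0"
proof -
  define p where "p = CHAR('a)"
  have p: "prime p" using assms prime_CHAR_semidom unfolding p_def by blast
  have pow: "g ^ Suc k \<in> range R \<and> \<sigma> (g ^ Suc k) = (g + 1) ^ Suc k" for k
  proof (induction k)
    case (Suc k)
    then show ?case
      using range_mult[OF g_in_range, of "g ^ Suc k"] \<sigma>_mult[OF g_in_range, of "g ^ Suc k"]
      by (simp add: \<sigma>_g)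
  qed (simp add: g_in_range \<sigma>_g)
  obtain k where k: "p = Suc k" using p by (metis not0_implies_Suc not_prime_0)
  define w where "w = g ^ p + smult (- 1) g"
  have "w \<in> range R"
    using pow[of k] unfolding w_def k by (intro range_add range_smult g_in_range) auto
  have "\<sigma> w = (g + 1) ^ p + smult (- 1) (g + 1)"
    unfolding w_def k using pow[of k] g_in_range
    by (subst \<sigma>_add) (auto simp: range_smult \<sigma>_smult \<sigma>_g simp del: power_Suc smult_minus_left)
  also have "(g + 1) ^ p = g ^ p + 1"
    using freshmans_dream[of p g 1] p by (simp add: p_def)
  finally have "\<sigma> w = w" by (simp add: w_def)
  then have "w = 0" using \<sigma>_fixed_eq_0 \<open>w \<in> range R\<close> by blast
  then have "g ^ p = g" by (simp add: w_def)
  then have "p * degree g = degree g" by (metis degree_power_eq degree_0 mult_0_right)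
  then show ?thesis using prime_gt_1_nat[OF p] by simp
qed

section \<open>Extending the shift to all polynomials\<close>

text \<open>Although the range need not contain \<open>1\<close>, it is a module over \<open>F[g]\<close>, and \<open>\<sigma>\<close> is semilinear.\<close>

lemma polynomial_in_g_times:
  assumes "b \<in> range R"
  shows "pcompose q g * b \<in> range R"
    and "\<sigma> (pcompose q g * b) = pcompose q (g + 1) * \<sigma> b"
proof -
  have "pcompose q g * b \<in> range R \<and> \<sigma> (pcompose q g * b) = pcompose q (g + 1) * \<sigma> b"
  proof (induction q)
    case 0
    then show ?case by (simp add: range_0 \<sigma>_0)
  next
    case (pCons c q)
    have eq: "pcompose (pCons c q) g * b = smult c b + g * (pcompose q g * b)"
      by (simp add: pcompose_pCons algebra_simps)
    have in1: "smult c b \<in> range R" "g * (pcompose q g * b) \<in> range R"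
      using assms pCons by (auto intro: range_smult range_mult g_in_range)
    have "\<sigma> (pcompose (pCons c q) g * b) = smult c (\<sigma> b) + (g + 1) * (pcompose q (g + 1) * \<sigma> b)"
      unfolding eq using in1 assms pCons by (simp add: \<sigma>_add \<sigma>_smult \<sigma>_mult g_in_range \<sigma>_g)
    then show ?case using range_add[OF in1] unfolding eq
      by (simp add: pcompose_pCons algebra_simps)
  qed
  then show "pcompose q g * b \<in> range R" "\<sigma> (pcompose q g * b) = pcompose q (g + 1) * \<sigma> b"
    by auto
qed

text \<open>The main step: \<open>x\<close> is a quotient of two elements of the range \<open>B\<close>. Work with ranks over \<open>F[g]\<close>
  and let \<open>r\<close> be the rank of \<open>B\<close>. Since \<open>x s = \<sigma> y - y\<close> for \<open>y = R (x s)\<close>, the module \<open>x B\<close> lies in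
  \<open>\<sigma> B + B\<close>. By semilinearity the rank of \<open>\<sigma> B\<close> is at most \<open>r\<close>, and \<open>\<sigma> B\<close> shares the element
  \<open>(g + 1) g\<close> with \<open>B\<close>. So modulo \<open>B\<close> the module \<open>x B\<close> has rank at most \<open>r - 1\<close>, and multiplication by \<open>x\<close> must
  send some nonzero element of \<open>B\<close> into \<open>B\<close>.\<close>

lemma multiple_of_x_in_range:
  assumes deg: "degree g > 0"
  obtains b where "b \<in> range R" and "b \<noteq> 0" and "[:0, 1:] * b \<in> range R"
proof -
  define x :: "'a poly" where "x = [:0, 1:]"
  \<comment> \<open>\<open>e = (g - 1) g\<close> is chosen so that \<open>\<sigma> e = g (g + 1)\<close> lies in the range again.\<close>
  define e where "e = pcompose [:-1, 1:] g * g"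
  have e: "e \<in> range R" unfolding e_def by (intro polynomial_in_g_times g_in_range)
  have \<sigma>_e: "\<sigma> e = pcompose [:1, 1:] g * g"
    unfolding e_def polynomial_in_g_times(2)[OF g_in_range] \<sigma>_g
    by (simp add: pcompose_pCons algebra_simps)
  have \<sigma>_e_range: "\<sigma> e \<in> range R"
    unfolding \<sigma>_e by (intro polynomial_in_g_times g_in_range)
  have "e \<noteq> 0"
    unfolding e_def using pcompose_eq_0[OF _ deg, of "[:-1, 1:]"] deg by auto
  obtain S where S: "indep_over g S" "S \<subseteq> range R" "e \<in> S"
    and span: "\<And>b. b \<in> range R \<Longrightarrow>
      \<exists>Q q. Q \<noteq> 0 \<and> pcompose Q g * b = (\<Sum>s\<in>S. pcompose (q s) g * s)"
    by (rule maximal_indep_over[OF deg e \<open>e \<noteq> 0\<close>]) iprover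
  have fin: "finite S" using S(1) by (simp add: indep_over_def)
  define y where "y s = R (x * s)" for s
  have xs: "x * s = \<sigma> (y s) - y s" for s by (simp add: y_def \<sigma>_R)
  have "\<forall>s. \<exists>Q q. Q \<noteq> 0 \<and> pcompose Q g * y s = (\<Sum>t\<in>S. pcompose (q t) g * t)"
    by (intro allI span) (simp add: y_def)
  then obtain Q0
    where "\<forall>s. \<exists>q. Q0 s \<noteq> 0 \<and> pcompose (Q0 s) g * y s = (\<Sum>t\<in>S. pcompose (q t) g * t)"
    by (rule choice[THEN exE])
  then obtain q0
    where "\<forall>s. Q0 s \<noteq> 0 \<and> pcompose (Q0 s) g * y s = (\<Sum>t\<in>S. pcompose (q0 s t) g * t)"
    by (rule choice[THEN exE])
  then have Q0: "Q0 s \<noteq> 0"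
    and q0: "pcompose (Q0 s) g * y s = (\<Sum>t\<in>S. pcompose (q0 s t) g * t)" for s
    by simp_all
  \<comment> \<open>\<open>\<sigma>\<close> turns the coefficients \<open>f(g)\<close> into \<open>f(g + 1)\<close>, which are again polynomials in \<open>g\<close>.\<close>
  define Q where "Q s = pcompose (Q0 s) [:1, 1:]" for s
  define q where "q s t = pcompose (q0 s t) [:1, 1:]" for s t
  have shift: "pcompose (pcompose f [:1, 1:]) g = pcompose f (g + 1)" for f
    by (simp add: pcompose_assoc[symmetric] pcompose_pCons one_pCons add.commute)
  have Q: "Q s \<noteq> 0" for s
    using Q0[of s] pcompose_eq_0[of "Q0 s" "[:1, 1:]"] by (auto simp: Q_def)
  have q: "pcompose (Q s) g * \<sigma> (y s) = (\<Sum>t\<in>S. pcompose (q s t) g * \<sigma> t)" for s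
  proof -
    have "pcompose (Q s) g * \<sigma> (y s) = \<sigma> (pcompose (Q0 s) g * y s)"
      by (simp add: Q_def shift polynomial_in_g_times(2) y_def)
    also have "\<dots> = (\<Sum>t\<in>S. \<sigma> (pcompose (q0 s t) g * t))"
      unfolding q0 using S(2) by (intro \<sigma>_sum polynomial_in_g_times(1)) auto
    also have "\<dots> = (\<Sum>t\<in>S. pcompose (q s t) g * \<sigma> t)"
      using S(2) by (intro sum.cong) (auto simp: q_def shift polynomial_in_g_times(2))
    finally show ?thesis .
  qed
  \<comment> \<open>The coordinate at \<open>e\<close> may be ignored because \<open>\<sigma> e\<close> is in the range: fewer equations than unknowns.\<close>
  have "\<exists>p. (\<exists>s\<in>S. p s \<noteq> 0) \<and> (\<forall>t\<in>S - {e}. (\<Sum>s\<in>S. p s * q s t) = 0)"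
  proof (rule homogeneous_system_nontrivial_solution)
    show "card (S - {e}) < card S" using fin S(3) by (rule card_Diff1_less)
  qed (use fin in auto)
  then obtain p where p: "\<exists>s\<in>S. p s \<noteq> 0" "\<And>t. t \<in> S - {e} \<Longrightarrow> (\<Sum>s\<in>S. p s * q s t) = 0"
    by blast
  define b where "b = (\<Sum>s\<in>S. pcompose (p s * Q s) g * s)"
  show ?thesis
  proof
    show "b \<in> range R"
      unfolding b_def using S(2) by (intro range_sum polynomial_in_g_times) auto
    show "b \<noteq> 0"
    proof
      assume "b = 0"
      then have "\<forall>s\<in>S. p s * Q s = 0"
        unfolding b_def by (rule S(1)[unfolded indep_over_def, THEN conjunct2, rule_format, THEN ballI])
      then show False using p(1) Q by auto
    qed
    have "(\<Sum>s\<in>S. pcompose (p s * Q s) g * \<sigma> (y s))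
        = (\<Sum>s\<in>S. pcompose (p s) g * (\<Sum>t\<in>S. pcompose (q s t) g * \<sigma> t))"
      by (simp add: pcompose_mult mult.assoc q)
    also have "\<dots> = (\<Sum>t\<in>S. pcompose (\<Sum>s\<in>S. p s * q s t) g * \<sigma> t)"
      unfolding sum_distrib_left
      by (subst sum.swap) (simp add: pcompose_sum pcompose_mult sum_distrib_right mult.assoc)
    also have "\<dots> = pcompose (\<Sum>s\<in>S. p s * q s e) g * \<sigma> e
        + (\<Sum>t\<in>S - {e}. pcompose (\<Sum>s\<in>S. p s * q s t) g * \<sigma> t)"
      using fin S(3) by (rule sum.remove)
    also have "(\<Sum>t\<in>S - {e}. pcompose (\<Sum>s\<in>S. p s * q s t) g * \<sigma> t) = 0"
      by (intro sum.neutral ballI) (simp only: p(2) pcompose_0 mult_zero_left)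
    finally have \<sigma>_part: "(\<Sum>s\<in>S. pcompose (p s * Q s) g * \<sigma> (y s))
        = pcompose (\<Sum>s\<in>S. p s * q s e) g * \<sigma> e" by simp
    have "x * b = (\<Sum>s\<in>S. pcompose (p s * Q s) g * (x * s))"
      by (simp add: b_def sum_distrib_left mult.left_commute)
    also have "\<dots> = pcompose (\<Sum>s\<in>S. p s * q s e) g * \<sigma> e
        - (\<Sum>s\<in>S. pcompose (p s * Q s) g * y s)"
      unfolding xs right_diff_distrib sum_subtractf \<sigma>_part ..
    finally have eq: "x * b = pcompose (\<Sum>s\<in>S. p s * q s e) g * \<sigma> e
        - (\<Sum>s\<in>S. pcompose (p s * Q s) g * y s)" .
    show "[:0, 1:] * b \<in> range R"
      unfolding x_def[symmetric] eq
      by (intro range_diff range_sum polynomial_in_g_times \<sigma>_e_range) (simp add: y_def)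
  qed
qed

text \<open>If \<open>b\<close> and \<open>x b\<close> lie in the range and \<open>n\<close> is the degree of \<open>g\<close>, so do \<open>x ^ i * b ^ n = (x * b) ^ i * b ^ (n - i)\<close> for \<open>i < n\<close>, and
  these generate \<open>b\<^sup>n F[x]\<close> over \<open>F[g]\<close>. A multiple of \<open>b\<^sup>n\<close> of the form \<open>q(g) g\<close> is taken as the witness, because
  its image \<open>q(g + 1) (g + 1)\<close> is visibly nonzero.\<close>

lemma conductor:
  assumes deg: "degree g > 0"
  obtains b where "\<And>f. b * f \<in> range R" and "\<sigma> b \<noteq> 0"
proof -
  obtain b where b: "b \<in> range R" "b \<noteq> 0" "[:0, 1:] * b \<in> range R"
    using multiple_of_x_in_range[OF deg] .
  define n where "n = degree g"
  have pow: "(c ^ Suc k) \<in> range R" if "c \<in> range R" for c k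
    using that by (induction k) (auto intro: range_mult)
  have cond: "b ^ n * f \<in> range R" for f
  proof -
    have monomials: "[:0, 1:] ^ i * b ^ n \<in> range R" if i: "i < n" for i
    proof -
      obtain j where j: "n = i + Suc j" using less_imp_Suc_add[OF i] by auto
      have eq: "[:0, 1:] ^ i * b ^ n = ([:0, 1:] * b) ^ i * b ^ Suc j"
        unfolding j power_add power_mult_distrib by (simp only: mult_ac)
      show ?thesis
      proof (cases i)
        case 0
        then show ?thesis unfolding eq using pow[OF b(1)] by simp
      next
        case (Suc k)
        then show ?thesis unfolding eq unfolding Suc by (intro range_mult pow b)
      qed
    qed
    obtain q where "f = (\<Sum>i<n. pcompose (q i) g * [:0, 1:] ^ i)"
      using expansion_in_powers_of_poly[OF deg] unfolding n_def by blast
    then have eq: "b ^ n * f = (\<Sum>i<n. pcompose (q i) g * ([:0, 1:] ^ i * b ^ n))"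
      by (simp only: sum_distrib_left mult_ac)
    show ?thesis
      unfolding eq by (intro range_sum polynomial_in_g_times monomials) simp
  qed
  obtain q where q: "q \<noteq> 0" "b ^ n dvd pcompose q g"
    using nonzero_multiple_in_subring[of "b ^ n" g] b(2) by auto
  then obtain h where h: "pcompose q g = b ^ n * h" by (elim dvdE)
  show ?thesis
  proof
    have "pcompose q g * g * f = b ^ n * (h * g * f)" for f
      by (simp add: h mult_ac)
    then show "pcompose q g * g * f \<in> range R" for f using cond by metis
    have "\<sigma> (pcompose q g * g) = pcompose q (g + 1) * (g + 1)"
      by (simp add: polynomial_in_g_times g_in_range \<sigma>_g)
    moreover have deg1: "degree (g + 1) > 0" using deg by (simp add: degree_add_eq_left)
    then have "pcompose q (g + 1) \<noteq> 0" using q(1) pcompose_eq_0 by blast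
    moreover have "g + 1 \<noteq> 0" using deg1 by auto
    ultimately show "\<sigma> (pcompose q g * g) \<noteq> 0" by simp
  qed
qed

text \<open>Let \<open>b\<close> be as in \<open>conductor\<close>. The map \<open>f \<mapsto> \<sigma>(b f) / \<sigma> b\<close> extends \<open>\<sigma>\<close> to a ring homomorphism from \<open>F[x]\<close> into
  the rational functions. The powers of the image of \<open>x\<close> have the common denominator \<open>\<sigma> b\<close>, so this
  image is a polynomial \<open>s\<close>, and the extended map is the substitution of \<open>s\<close> for \<open>x\<close>. It still sends \<open>g\<close> to
  \<open>g + 1\<close>.\<close>

lemma shift_is_substitution:
  assumes deg: "degree g > 0"
  obtains s where "pcompose g s = g + 1"
proof -
  obtain b where cond: "\<And>f. b * f \<in> range R" and nz: "\<sigma> b \<noteq> 0"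
    using conductor[OF deg] by blast
  have b: "b \<in> range R" using cond[of 1] by simp
  have swap: "\<sigma> b * \<sigma> (b * (f * h)) = \<sigma> (b * f) * \<sigma> (b * h)" for f h
  proof -
    have "\<sigma> b * \<sigma> (b * (f * h)) = \<sigma> (b * (b * (f * h)))"
      using \<sigma>_mult[OF b cond] by simp
    also have "b * (b * (f * h)) = (b * f) * (b * h)" by (simp only: mult_ac)
    finally show ?thesis by (simp add: \<sigma>_mult cond)
  qed
  let ?x = "[:0, 1:] :: 'a poly"
  have pow: "\<sigma> b ^ k * \<sigma> (b * ?x ^ k) = \<sigma> b * \<sigma> (b * ?x) ^ k" for k
  proof (induction k)
    case (Suc k)
    have "\<sigma> b ^ Suc k * \<sigma> (b * ?x ^ Suc k) = \<sigma> b ^ k * (\<sigma> b * \<sigma> (b * (?x * ?x ^ k)))"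
      by (simp only: power_Suc mult_ac)
    also have "\<dots> = \<sigma> (b * ?x) * (\<sigma> b ^ k * \<sigma> (b * ?x ^ k))"
      unfolding swap by (simp only: mult_ac)
    finally show ?case unfolding Suc by (simp only: power_Suc mult_ac)
  qed simp
  have "\<sigma> b dvd \<sigma> (b * ?x)"
  proof (rule almost_integral_imp_dvd[OF nz])
    show "\<sigma> b ^ k dvd \<sigma> b * \<sigma> (b * ?x) ^ k" for k
      unfolding pow[symmetric] by simp
  qed
  then obtain s where s: "\<sigma> (b * ?x) = \<sigma> b * s" by (elim dvdE)
  have subst: "\<sigma> (b * f) = \<sigma> b * pcompose f s" for f
  proof (induction f)
    case 0
    then show ?case by (simp add: \<sigma>_0)
  next
    case (pCons c f)
    have "\<sigma> b * \<sigma> (b * (?x * f)) = \<sigma> b * (\<sigma> b * (s * pcompose f s))"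
      unfolding swap s pCons by (simp only: mult_ac)
    then have xf: "\<sigma> (b * (?x * f)) = \<sigma> b * (s * pcompose f s)" using nz by simp
    have "b * pCons c f = smult c b + b * (?x * f)"
      by simp
    then have "\<sigma> (b * pCons c f) = smult c (\<sigma> b) + \<sigma> b * (s * pcompose f s)"
      using b cond by (simp only: \<sigma>_add \<sigma>_smult range_smult xf)
    then show ?case by (simp add: pcompose_pCons algebra_simps)
  qed
  have "\<sigma> b * pcompose g s = \<sigma> b * (g + 1)"
    using subst[of g] \<sigma>_mult[OF b g_in_range] unfolding \<sigma>_g by metis
  then have "pcompose g s = g + 1" using nz mult_left_cancel by blast
  then show ?thesis by (rule that)
qed

section \<open>The classification\<close>

lemma degree_g_eq_1:
  assumes "CHAR('a) = 0" and "degree g > 0"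
  shows "degree g = 1"
  using shift_is_substitution[OF assms(2)] degree_1_if_composition_shifts[OF assms] by metis

text \<open>The value \<open>P\<close> of the model operator at \<open>x\<^sup>n\<close> is divisible by \<open>x\<close>, so \<open>P(g)\<close> lies in the range, and
  \<open>\<sigma>(P(g)) - P(g) = P(g + 1) - P(g) = g\<^sup>n\<close>. That is what it means for \<open>P(g)\<close> to be \<open>R (g\<^sup>n)\<close>.\<close>

lemma R_pcompose_g:
  assumes char0: "CHAR('a) = 0"
  shows "R (pcompose f g) = pcompose (R0 f) g"
proof -
  have power: "R (g ^ n) = pcompose (R0_monomial n) g" for n
  proof -
    obtain q where q: "R0_monomial n = [:0, 1:] * (q :: 'a poly)"
      using poly_R0_monomial_0[OF char0, of n] by (auto simp: poly_eq_0_iff_dvd elim: dvdE)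
    have eq: "pcompose (R0_monomial n) g = pcompose q g * g"
      by (simp add: q pcompose_mult pcompose_pCons mult.commute)
    have in_range: "pcompose (R0_monomial n) g \<in> range R"
      unfolding eq by (intro polynomial_in_g_times g_in_range)
    have "\<sigma> (pcompose (R0_monomial n) g) = pcompose (R0_monomial n) (g + 1)"
      unfolding eq polynomial_in_g_times(2)[OF g_in_range] \<sigma>_g
      by (simp add: q pcompose_mult pcompose_pCons mult.commute)
    also have "\<dots> = pcompose (pcompose (R0_monomial n) [:1, 1:]) g"
      by (simp add: pcompose_assoc[symmetric] pcompose_pCons one_pCons add.commute)
    also have "\<dots> = pcompose (R0_monomial n + [:0, 1:] ^ n) g"
      using R0_monomial_shift[OF char0, of n] by (simp add: algebra_simps)
    also have "\<dots> = pcompose (R0_monomial n) g + g ^ n"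
      using pcompose_monom[of 1 n g] by (simp add: pcompose_add monom_altdef)
    finally have \<sigma>_eq: "\<sigma> (pcompose (R0_monomial n) g) = pcompose (R0_monomial n) g + g ^ n" .
    obtain h where h: "pcompose (R0_monomial n) g = R h" using in_range by auto
    then show ?thesis using \<sigma>_eq by (simp add: \<sigma>_R)
  qed
  have R_sum: "R (sum u I) = (\<Sum>i\<in>I. R (u i))" for u and I :: "nat set"
    by (induction I rule: infinite_finite_induct) (auto simp: R_0 R_add)
  have "pcompose f g = pcompose (\<Sum>i\<le>degree f. monom (coeff f i) i) g"
    by (simp add: poly_as_sum_of_monoms)
  then have "R (pcompose f g) = (\<Sum>i\<le>degree f. smult (coeff f i) (R (g ^ i)))"
    by (simp add: pcompose_sum pcompose_monom R_sum R_smult)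
  then show ?thesis by (simp add: power R0_def pcompose_sum pcompose_smult)
qed

end

lemma poly_algebra_automorphism_pcompose:
  fixes g :: "'a::field poly"
  assumes "degree g = 1"
  shows "poly_algebra_automorphism (\<lambda>f. pcompose f g)"
proof -
  obtain c t where t: "g = pCons c t" by (cases g)
  with assms have "degree t = 0" "t \<noteq> 0" by (auto split: if_splits)
  then obtain d where g: "g = [:c, d:]" and d: "d \<noteq> 0"
    unfolding t by (auto elim: degree_eq_zeroE)
  define h where "h = [:- c / d, 1 / d:]"
  have "pcompose h g = [:0, 1:]" "pcompose g h = [:0, 1:]"
    using d by (simp_all add: g h_def pcompose_pCons)
  then have "bij (\<lambda>f. pcompose f g)"
    by (intro o_bij[of "\<lambda>f. pcompose f h"]) (auto simp: fun_eq_iff pcompose_assoc[symmetric])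
  then show ?thesis
    by (auto simp: poly_algebra_automorphism_def linear_smult_iff pcompose_add pcompose_smult
        pcompose_mult pcompose_1)
qed

theorem theorem4p5:
  fixes R :: "'a::field poly \<Rightarrow> 'a poly"
  assumes "rota_baxter_weight1 R" and "inj R"
  shows "(CHAR('a) > 0 \<longrightarrow> R = (\<lambda>f. - f)) \<and>
         (CHAR('a) = 0 \<longrightarrow>
            R = (\<lambda>f. - f) \<or>
            (\<exists>\<psi>. poly_algebra_automorphism \<psi> \<and> inv \<psi> \<circ> R \<circ> \<psi> = R0))"
proof -
  interpret injective_rota_baxter R
    using assms by unfold_locales (auto simp: rota_baxter_weight1_def linear_smult_iff)
  have char0: "\<exists>\<psi>. poly_algebra_automorphism \<psi> \<and> inv \<psi> \<circ> R \<circ> \<psi> = R0"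
    if "CHAR('a) = 0" "R \<noteq> (\<lambda>f. - f)"
  proof -
    define \<psi> where "\<psi> f = pcompose f g" for f
    have "degree g > 0" using minus_id_if_degree_g_eq_0 that(2) by blast
    then have aut: "poly_algebra_automorphism \<psi>"
      using poly_algebra_automorphism_pcompose degree_g_eq_1[OF that(1)] unfolding \<psi>_def by blast
    have "inv \<psi> (R (\<psi> f)) = R0 f" for f
      using aut R_pcompose_g[OF that(1), of f]
      by (simp add: \<psi>_def[symmetric] poly_algebra_automorphism_def bij_is_inj)
    then show ?thesis using aut by (auto simp: fun_eq_iff)
  qed
  show ?thesis
  proof (intro conjI impI)
    assume "CHAR('a) > 0"
    then show "R = (\<lambda>f. - f)"
      by (intro minus_id_if_degree_g_eq_0 degree_g_eq_0_if_prime_char)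
  next
    assume zero: "CHAR('a) = 0"
    show "R = (\<lambda>f. - f) \<or>
        (\<exists>\<psi>. poly_algebra_automorphism \<psi> \<and> inv \<psi> \<circ> R \<circ> \<psi> = R0)"
    proof (cases "R = (\<lambda>f. - f)")
      case False
      show ?thesis by (rule disjI2[OF char0[OF zero False]])
    qed (rule disjI1)
  qed
qed

end
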